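(* Let $(X,\mathcal{A},\lambda)$ be a $\sigma$-finite measure space and $T:X\to X$ a null-preserving map. Then the following are equivalent: (i) the system $(X,\mathcal{A},\lambda,T)$ is conservative and ergodic; (ii) for every $A\in\mathcal{A}$ with $\lambda(A)>0$ we have $X\overset{.}{=}\bigcup_{n\ge1}\hat{T}^nA$; (iii) for every $A\in\mathcal{A}$ with $\lambda(A)>0$ we have $X\overset{.}{=}\limsup_{n\to\infty}\hat{T}^nA:=\bigcap_{m\ge1}\bigcup_{n\ge m}\hat{T}^nA$; (iv) for every $A\in\mathcal{A}$ with $\lambda(A)>0$ and $\hat{T}A\overset{.}{\subseteq}A$ we have $X\overset{.}{=}A$.
   Context: For $A,B\in\mathcal{A}$ write $A\overset{.}{\subseteq}B$ if $\lambda(A\setminus B)=0$ and $A\overset{.}{=}B$ if $\lambda(A\triangle B)=0$. A measurable map $T:X\to X$ is null-preserving if $\lambda(A)=0$ implies $\lambda(T^{-1}A)=0$ for $A\in\mathcal{A}$. An essential image of $A\in\mathcal{A}$ under $T$ is a set $A'\in\mathcal{A}$ such that $T^{-1}A'\overset{.}{\supseteq}A$ and such that every $B'\in\mathcal{A}$ with $T^{-1}B'\overset{.}{\supseteq}A$ satisfies $B'\overset{.}{\supseteq}A'$. In the present ($\sigma$-finite, null-preserving) setting every $A\in\mathcal{A}$ has essential images and they form exactly one equivalence class under $\overset{.}{=}$; $\hat{T}A$ denotes an arbitrary fixed essential image of $A$, and $\hat{T}^n$ is the $n$-fold iterate. A set $W\in\mathcal{A}$ is wandering if $W\cap T^{-n}W\overset{.}{=}\varnothing$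 for all $n\ge1$; the system is conservative if every wandering set is a null-set. A set $A\in\mathcal{A}$ is invariant if $A\overset{.}{=}T^{-1}A$; the system is ergodic if every invariant set $A$ satisfies $\lambda(A)=0$ or $\lambda(A^c)=0$. *)

theory Defs
  imports "HOL-Analysis.Analysis"
begin

definition ae_subset :: "'a measure \<Rightarrow> 'a set \<Rightarrow> 'a set \<Rightarrow> bool" where
  "ae_subset M A B \<longleftrightarrow> emeasure M (A - B) = 0"

definition ae_equal :: "'a measure \<Rightarrow> 'a set \<Rightarrow> 'a set \<Rightarrow> bool" where
  "ae_equal M A B \<longleftrightarrow> emeasure M ((A - B) \<union> (B - A)) = 0"

text \<open>Preimages are intersected with the carrier, since \<open>T\<close> is a total function on the type.\<close>

definition preim :: "'a measure \<Rightarrow> ('a \<Rightarrow> 'a) \<Rightarrow> 'a set \<Rightarrow> 'a set" where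
  "preim M T A = T -` A \<inter> space M"

definition null_preserving :: "'a measure \<Rightarrow> ('a \<Rightarrow> 'a) \<Rightarrow> bool" where
  "null_preserving M T \<longleftrightarrow>
     T \<in> measurable M M \<and>
     (\<forall>A\<in>sets M. emeasure M A = 0 \<longrightarrow> emeasure M (preim M T A) = 0)"

definition essential_image :: "'a measure \<Rightarrow> ('a \<Rightarrow> 'a) \<Rightarrow> 'a set \<Rightarrow> 'a set \<Rightarrow> bool" where
  "essential_image M T A A' \<longleftrightarrow>
     A' \<in> sets M \<and>
     ae_subset M A (preim M T A') \<and>
     (\<forall>B'\<in>sets M. ae_subset M A (preim M T B') \<longrightarrow> ae_subset M A' B')"

text \<open>\<open>That\<close> is an arbitrary fixed choice of one essential image for each measurable set.
  Such choices exist and are unique up to null sets in the \<open>\<sigma>\<close>-finite, null-preserving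
  setting; see the two lemmas at the end of this theory.\<close>

definition essential_image_choice ::
    "'a measure \<Rightarrow> ('a \<Rightarrow> 'a) \<Rightarrow> ('a set \<Rightarrow> 'a set) \<Rightarrow> bool" where
  "essential_image_choice M T That \<longleftrightarrow> (\<forall>A\<in>sets M. essential_image M T A (That A))"

definition wandering :: "'a measure \<Rightarrow> ('a \<Rightarrow> 'a) \<Rightarrow> 'a set \<Rightarrow> bool" where
  "wandering M T W \<longleftrightarrow>
     W \<in> sets M \<and> (\<forall>n\<ge>1. ae_equal M (W \<inter> preim M (T ^^ n) W) {})"

definition conservative :: "'a measure \<Rightarrow> ('a \<Rightarrow> 'a) \<Rightarrow> bool" where
  "conservative M T \<longleftrightarrow> (\<forall>W. wandering M T W \<longrightarrow> emeasure M W = 0)"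

definition invariant_set :: "'a measure \<Rightarrow> ('a \<Rightarrow> 'a) \<Rightarrow> 'a set \<Rightarrow> bool" where
  "invariant_set M T A \<longleftrightarrow> A \<in> sets M \<and> ae_equal M A (preim M T A)"

definition ergodic :: "'a measure \<Rightarrow> ('a \<Rightarrow> 'a) \<Rightarrow> bool" where
  "ergodic M T \<longleftrightarrow>
     (\<forall>A. invariant_set M T A \<longrightarrow> emeasure M A = 0 \<or> emeasure M (space M - A) = 0)"

lemma ex_essential_image:
  assumes "sigma_finite_measure M" "null_preserving M T" "A \<in> sets M"
  shows "\<exists>A'. essential_image M T A A'"
proof -
  interpret sigma_finite_measure M by fact
  have T[measurable]: "T \<in> measurable M M"
    and np: "\<And>B. B \<in> sets M \<Longrightarrow> emeasure M B = 0 \<Longrightarrow> emeasure M (T -` B \<inter> space M) = 0"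
    using assms(2) by (auto simp: null_preserving_def preim_def)
  have A[measurable]: "A \<in> sets M" by fact
  define N where "N = distr (density M (indicator A)) M T"
  have sN[simp]: "sets N = sets M" by (simp add: N_def)
  have N: "emeasure N B = emeasure M (A \<inter> (T -` B \<inter> space M))" if [measurable]: "B \<in> sets M" for B
    by (simp add: N_def emeasure_distr emeasure_density mult.commute
        flip: indicator_inter_arith)
  have "absolutely_continuous M N"
    unfolding absolutely_continuous_def
  proof
    fix B assume "B \<in> null_sets M"
    then have B[measurable]: "B \<in> sets M" and "emeasure M B = 0" by auto
    then have "emeasure M (T -` B \<inter> space M) = 0" by (intro np)
    then have "emeasure M (A \<inter> (T -` B \<inter> space M)) = 0"
      by (metis B T emeasure_eq_0 inf_le2 measurable_sets)
    then show "B \<in> null_sets N" using N[OF B] B by (auto simp: null_sets_def)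
  qed
  from Radon_Nikodym[OF this sN] obtain f where f[measurable]: "f \<in> borel_measurable M"
    and fN: "density M f = N" by auto
  define A' where "A' = {x\<in>space M. f x \<noteq> 0}"
  have A'[measurable]: "A' \<in> sets M" unfolding A'_def by measurable
  have key: "emeasure N B = 0 \<longleftrightarrow> emeasure M (A' \<inter> B) = 0" if [measurable]: "B \<in> sets M" for B
  proof -
    have "emeasure N B = (\<integral>\<^sup>+x. f x * indicator B x \<partial>M)"
      by (simp add: emeasure_density flip: fN)
    also have "\<dots> = 0 \<longleftrightarrow> emeasure M {x\<in>space M. f x * indicator B x \<noteq> 0} = 0"
      by (subst nn_integral_0_iff) auto
    also have "{x\<in>space M. f x * indicator B x \<noteq> 0} = A' \<inter> B"
      using sets.sets_into_space[OF that] by (auto simp: A'_def indicator_def)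
    finally show ?thesis .
  qed
  have main: "ae_subset M A (preim M T B) \<longleftrightarrow> ae_subset M A' B" if [measurable]: "B \<in> sets M" for B
  proof -
    have "A - preim M T B = A \<inter> (T -` (space M - B) \<inter> space M)"
      using sets.sets_into_space[OF A] measurable_space[OF T] by (auto simp: preim_def)
    moreover have "A' \<inter> (space M - B) = A' - B"
      using sets.sets_into_space[OF A'] by auto
    ultimately show ?thesis
      using N[of "space M - B"] key[of "space M - B"] by (simp add: ae_subset_def)
  qed
  have "essential_image M T A A'"
    unfolding essential_image_def by (simp add: main) (simp add: ae_subset_def)
  then show ?thesis by blast
qed

lemma essential_image_unique:
  assumes "essential_image M T A A'" "essential_image M T A A''"
  shows "ae_equal M A' A''"
proof -
  have "A' - A'' \<in> null_sets M" "A'' - A' \<in> null_sets M"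
    using assms by (auto simp: essential_image_def ae_subset_def null_sets_def)
  then have "(A' - A'') \<union> (A'' - A') \<in> null_sets M" by (rule null_sets.Un)
  then show ?thesis by (simp add: ae_equal_def null_sets_def)
qed

end

theory Submission
  imports Defs
begin

text \<open>Everything rests on the adjunction between essential images and preimages: \<open>That A\<close> is
  almost contained in \<open>B\<close> iff \<open>A\<close> is almost contained in the preimage of \<open>B\<close>. Consequently the
  tails \<open>B\<^sub>m = (\<Union>n\<ge>m. That\<^sup>n A)\<close> satisfy \<open>B\<^sub>m \<subseteq> T\<^sup>-\<^sup>1 B\<^sub>m\<close> up to null sets. In a conservative
  system every such set \<open>C\<close> is invariant, because \<open>T\<^sup>-\<^sup>1 C - C\<close> is wandering, so by ergodicity
  all tails are conull. Conversely, if \<open>W\<close> is wandering, then by adjunction no \<open>That\<^sup>n W\<close> with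
  \<open>n \<ge> 1\<close> meets \<open>W\<close>; so the forward orbit of \<open>W\<close>, a forward invariant set, misses \<open>W\<close>.\<close>

section \<open>Almost inclusion and almost equality as almost-everywhere statements\<close>

lemma ae_subset_iff_AE:
  assumes "A \<in> sets M" "B \<in> sets M"
  shows "ae_subset M A B \<longleftrightarrow> (AE x in M. x \<in> A \<longrightarrow> x \<in> B)"
proof -
  have "(AE x in M. x \<in> A \<longrightarrow> x \<in> B) \<longleftrightarrow> (AE x in M. x \<notin> A - B)"
    by (intro AE_cong) auto
  also have "\<dots> \<longleftrightarrow> A - B \<in> null_sets M"
    using assms by (intro AE_iff_null_sets[symmetric]) auto
  finally show ?thesis
    using assms by (auto simp: ae_subset_def null_sets_def)
qed

lemma ae_equal_iff_AE:
  assumes "A \<in> sets M" "B \<in> sets M"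
  shows "ae_equal M A B \<longleftrightarrow> (AE x in M. x \<in> A \<longleftrightarrow> x \<in> B)"
proof -
  have "(AE x in M. x \<in> A \<longleftrightarrow> x \<in> B) \<longleftrightarrow> (AE x in M. x \<notin> (A - B) \<union> (B - A))"
    by (intro AE_cong) auto
  also have "\<dots> \<longleftrightarrow> (A - B) \<union> (B - A) \<in> null_sets M"
    using assms by (intro AE_iff_null_sets[symmetric]) auto
  finally show ?thesis
    using assms by (auto simp: ae_equal_def null_sets_def)
qed

lemma emeasure_eq_0_iff_AE:
  assumes "A \<in> sets M"
  shows "emeasure M A = 0 \<longleftrightarrow> (AE x in M. x \<notin> A)"
  using AE_iff_null_sets[OF assms] assms by (auto simp: null_sets_def)

lemma ae_subset_trans:
  assumes "A \<in> sets M" "B \<in> sets M" "C \<in> sets M" "ae_subset M A B" "ae_subset M B C"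
  shows "ae_subset M A C"
  using assms by (auto simp: ae_subset_iff_AE)

lemma subset_imp_ae_subset: "A \<subseteq> B \<Longrightarrow> ae_subset M A B"
  by (metis Diff_eq_empty_iff ae_subset_def emeasure_empty)

text \<open>Countability of \<open>I\<close> allows the exceptional null sets of all the inclusions
  to be merged into one.\<close>

lemma ae_subset_UN:
  assumes "countable I" "\<And>i. i \<in> I \<Longrightarrow> A i \<in> sets M" "B \<in> sets M"
    and "\<And>i. i \<in> I \<Longrightarrow> ae_subset M (A i) B"
  shows "ae_subset M (\<Union>i\<in>I. A i) B"
proof -
  have "AE x in M. \<forall>i\<in>I. x \<in> A i \<longrightarrow> x \<in> B"
    unfolding AE_ball_countable[OF assms(1)] using assms by (simp add: ae_subset_iff_AE)
  then have "AE x in M. x \<in> (\<Union>i\<in>I. A i) \<longrightarrow> x \<in> B"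
    by (rule AE_mp) auto
  moreover have "(\<Union>i\<in>I. A i) \<in> sets M"
    using assms by (intro sets.countable_UN') auto
  ultimately show ?thesis using assms by (simp add: ae_subset_iff_AE)
qed

lemma ae_equal_space_iff:
  assumes "A \<in> sets M"
  shows "ae_equal M (space M) A \<longleftrightarrow> (AE x in M. x \<in> A)"
proof -
  have "ae_equal M (space M) A \<longleftrightarrow> (AE x in M. x \<in> space M \<longleftrightarrow> x \<in> A)"
    using assms by (simp add: ae_equal_iff_AE)
  also have "\<dots> \<longleftrightarrow> (AE x in M. x \<in> A)" by (intro AE_cong) auto
  finally show ?thesis .
qed

text \<open>This turns the disjointness in the definition of \<open>wandering\<close> into an almost
  inclusion, the form to which the adjunction applies.\<close>

lemma ae_equal_empty_inter_iff:
  assumes "A \<in> sets M" "B \<in> sets M"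
  shows "ae_equal M (A \<inter> B) {} \<longleftrightarrow> ae_subset M A (space M - B)"
proof -
  have "ae_equal M (A \<inter> B) {} \<longleftrightarrow> (AE x in M. x \<notin> A \<inter> B)"
    using assms by (simp add: ae_equal_iff_AE)
  also have "\<dots> \<longleftrightarrow> (AE x in M. x \<in> A \<longrightarrow> x \<in> space M - B)"
    by (intro AE_cong) auto
  also have "\<dots> \<longleftrightarrow> ae_subset M A (space M - B)"
    using assms by (intro ae_subset_iff_AE[symmetric]) auto
  finally show ?thesis .
qed

section \<open>Preimages under null-preserving maps\<close>

locale null_preserving_system =
  fixes M :: "'a measure" and T :: "'a \<Rightarrow> 'a"
  assumes np: "null_preserving M T"
begin

lemma T_measurable[measurable]: "T \<in> measurable M M"
  using np by (simp add: null_preserving_def)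

lemma sets_preim: "A \<in> sets M \<Longrightarrow> preim M T A \<in> sets M"
  unfolding preim_def by measurable

lemma sets_preim_funpow: "A \<in> sets M \<Longrightarrow> preim M (T ^^ n) A \<in> sets M"
  unfolding preim_def by measurable

text \<open>Holds because \<open>T\<close> maps \<open>space M\<close> into itself. With a single
  \<open>T\<close> outermost, inductions can peel it off by \<open>preim_mono\<close> or by the
  adjunction.\<close>

lemma preim_funpow_Suc: "preim M (T ^^ Suc n) A = preim M T (preim M (T ^^ n) A)"
  using measurable_space[OF T_measurable] by (auto simp: preim_def funpow_Suc_right simp del: funpow.simps)

text \<open>Null preservation enters here: the difference of the preimages is the preimage of the
  null set \<open>A - B\<close>.\<close>

lemma preim_mono:
  assumes "A \<in> sets M" "B \<in> sets M" "ae_subset M A B"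
  shows "ae_subset M (preim M T A) (preim M T B)"
proof -
  have "preim M T A - preim M T B = preim M T (A - B)" by (auto simp: preim_def)
  then show ?thesis
    using assms np by (simp add: ae_subset_def null_preserving_def)
qed

lemma subset_preim_funpow:
  assumes "A \<in> sets M" "ae_subset M A (preim M T A)"
  shows "ae_subset M A (preim M (T ^^ n) A)"
proof (induction n)
  case 0
  then show ?case using sets.sets_into_space[OF assms(1)]
    by (intro subset_imp_ae_subset) (auto simp: preim_def)
next
  case (Suc n)
  have "ae_subset M (preim M T A) (preim M (T ^^ Suc n) A)"
    unfolding preim_funpow_Suc using Suc assms by (intro preim_mono sets_preim_funpow)
  with assms show ?case
    by (meson ae_subset_trans sets_preim sets_preim_funpow)
qed

text \<open>A point of \<open>preim M T A - A\<close> enters \<open>A\<close> after one step and, up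
  to a null set, stays there forever, so it never returns to the complement of \<open>A\<close>.
  Hence this difference is wandering, thus null.\<close>

lemma conservative_subset_preim_imp_invariant:
  assumes "conservative M T" and A: "A \<in> sets M" and sub: "ae_subset M A (preim M T A)"
  shows "invariant_set M T A"
proof -
  define W where "W = preim M T A - A"
  have W: "W \<in> sets M" using A unfolding W_def by (intro sets.Diff sets_preim)
  have "ae_equal M (W \<inter> preim M (T ^^ n) W) {}" if "n \<ge> 1" for n
  proof -
    obtain k where k: "n = Suc k" using \<open>n \<ge> 1\<close> by (cases n) auto
    have "ae_subset M (preim M T A) (preim M (T ^^ n) A)"
      unfolding k preim_funpow_Suc using A sub
      by (intro preim_mono sets_preim_funpow subset_preim_funpow)
    moreover have "ae_subset M W (preim M T A)" unfolding W_def
      by (intro subset_imp_ae_subset) auto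
    ultimately have "ae_subset M W (preim M (T ^^ n) A)"
      using A W by (meson ae_subset_trans sets_preim sets_preim_funpow)
    \<comment> \<open>\<open>W\<close> is disjoint from \<open>A\<close>, so a point that
      \<open>T ^^ n\<close> sends into \<open>A\<close> is not sent into \<open>W\<close>.\<close>
    moreover have "ae_subset M (preim M (T ^^ n) A) (space M - preim M (T ^^ n) W)"
      by (intro subset_imp_ae_subset) (auto simp: preim_def W_def)
    ultimately have "ae_subset M W (space M - preim M (T ^^ n) W)"
      using A W by (meson ae_subset_trans sets.compl_sets sets_preim_funpow)
    then show ?thesis using W by (simp add: ae_equal_empty_inter_iff sets_preim_funpow)
  qed
  then have "emeasure M W = 0"
    using W assms(1) by (auto simp: wandering_def conservative_def)
  then have "ae_subset M (preim M T A) A" by (simp add: ae_subset_def W_def)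
  with A sub show ?thesis
    by (auto simp: invariant_set_def ae_equal_iff_AE ae_subset_iff_AE sets_preim)
qed

end

section \<open>Essential images and their iterates\<close>

locale essential_image_system = null_preserving_system +
  fixes That :: "'a set \<Rightarrow> 'a set"
  assumes choice: "essential_image_choice M T That"
begin

lemma sets_That: "A \<in> sets M \<Longrightarrow> That A \<in> sets M"
  using choice by (auto simp: essential_image_choice_def essential_image_def)

lemma sets_That_funpow: "A \<in> sets M \<Longrightarrow> (That ^^ n) A \<in> sets M"
  by (induction n) (auto simp: sets_That)

text \<open>The adjunction. Minimality of the essential image gives one direction; the other
  composes the inclusion of \<open>A\<close> in \<open>preim M T (That A)\<close> with monotonicity
  of preimages.\<close>

lemma That_subset_iff:
  assumes A: "A \<in> sets M" and B: "B \<in> sets M"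
  shows "ae_subset M (That A) B \<longleftrightarrow> ae_subset M A (preim M T B)"
proof
  have ei: "essential_image M T A (That A)"
    using choice A by (simp add: essential_image_choice_def)
  show "ae_subset M (That A) B" if "ae_subset M A (preim M T B)"
    using ei B that by (auto simp: essential_image_def)
  assume "ae_subset M (That A) B"
  then have "ae_subset M (preim M T (That A)) (preim M T B)"
    using A B by (intro preim_mono sets_That)
  moreover have "ae_subset M A (preim M T (That A))"
    using ei by (simp add: essential_image_def)
  ultimately show "ae_subset M A (preim M T B)"
    using A B by (meson ae_subset_trans sets_preim sets_That)
qed

lemma That_funpow_subset_iff:
  assumes "A \<in> sets M" "B \<in> sets M"
  shows "ae_subset M ((That ^^ n) A) B \<longleftrightarrow> ae_subset M A (preim M (T ^^ n) B)"
  using assms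
\<comment> \<open>\<open>A\<close> must vary, since the induction hypothesis is applied to
  \<open>That A\<close>.\<close>
proof (induction n arbitrary: A)
  case 0
  have "B \<inter> space M = B" using sets.sets_into_space[OF 0(2)] by auto
  then show ?case by (simp add: preim_def)
next
  case (Suc n)
  have "ae_subset M ((That ^^ Suc n) A) B \<longleftrightarrow> ae_subset M ((That ^^ n) (That A)) B"
    by (simp add: funpow_swap1)
  also have "\<dots> \<longleftrightarrow> ae_subset M (That A) (preim M (T ^^ n) B)"
    using Suc by (simp add: sets_That)
  also have "\<dots> \<longleftrightarrow> ae_subset M A (preim M (T ^^ Suc n) B)"
    unfolding preim_funpow_Suc using Suc by (intro That_subset_iff sets_preim_funpow)
  finally show ?case .
qed

lemma emeasure_That_funpow_pos:
  assumes "A \<in> sets M" "emeasure M A > 0"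
  shows "emeasure M ((That ^^ n) A) > 0"
proof -
  have "emeasure M ((That ^^ n) A) = 0 \<longleftrightarrow> emeasure M A = 0"
    \<comment> \<open>The adjunction with target \<open>{}\<close>: being almost contained in
      \<open>{}\<close> means being null, and the preimage of \<open>{}\<close> is empty.\<close>
    using That_funpow_subset_iff[OF assms(1) sets.empty_sets, of n]
    by (simp add: ae_subset_def preim_def)
  with assms(2) show ?thesis by (simp add: zero_less_iff_neq_zero)
qed

lemma sets_tail: "A \<in> sets M \<Longrightarrow> (\<Union>n\<in>{m..}. (That ^^ n) A) \<in> sets M"
  by (intro sets.countable_UN') (auto simp: sets_That_funpow)

lemma emeasure_tail_pos:
  assumes "A \<in> sets M" "emeasure M A > 0"
  shows "emeasure M (\<Union>n\<in>{m..}. (That ^^ n) A) > 0"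
proof -
  have "emeasure M ((That ^^ m) A) \<le> emeasure M (\<Union>n\<in>{m..}. (That ^^ n) A)"
    using assms by (intro emeasure_mono sets_tail) auto
  with emeasure_That_funpow_pos[OF assms] show ?thesis by (rule less_le_trans)
qed

lemma tail_subset_preim:
  assumes A: "A \<in> sets M"
  shows "ae_subset M (\<Union>n\<in>{m..}. (That ^^ n) A) (preim M T (\<Union>n\<in>{m..}. (That ^^ n) A))"
proof (intro ae_subset_UN sets_preim sets_tail sets_That_funpow A)
  fix n assume n: "n \<in> {m..}"
  \<comment> \<open>Applying \<open>That\<close> only raises the index, so each image stays in the
    tail; the adjunction turns this into an inclusion in the preimage.\<close>
  have "That ((That ^^ n) A) \<subseteq> (\<Union>n\<in>{m..}. (That ^^ n) A)"
    using n by (auto intro!: bexI[of _ "Suc n"])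
  then show "ae_subset M ((That ^^ n) A) (preim M T (\<Union>n\<in>{m..}. (That ^^ n) A))"
    using A by (simp add: subset_imp_ae_subset sets_That_funpow sets_tail flip: That_subset_iff)
qed auto

text \<open>Each tail is non-null and almost contained in its preimage, hence invariant by
  conservativity and conull by ergodicity. Countably many conull tails have a conull
  intersection.\<close>

lemma conservative_ergodic_imp_limsup_conull:
  assumes "conservative M T" "ergodic M T" and A: "A \<in> sets M" and pos: "emeasure M A > 0"
  shows "AE x in M. x \<in> (\<Inter>m\<in>{1..}. \<Union>n\<in>{m..}. (That ^^ n) A)"
proof -
  have "AE x in M. x \<in> (\<Union>n\<in>{m..}. (That ^^ n) A)" for m
  proof -
    define B where "B = (\<Union>n\<in>{m..}. (That ^^ n) A)"
    have B: "B \<in> sets M" unfolding B_def by (intro sets_tail A)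
    have "invariant_set M T B"
      using assms(1) A tail_subset_preim sets_tail unfolding B_def
      by (intro conservative_subset_preim_imp_invariant)
    then have "emeasure M (space M - B) = 0"
      using assms(2) emeasure_tail_pos[OF A pos, of m] unfolding ergodic_def B_def
      by (metis less_irrefl)
    then have "AE x in M. x \<notin> space M - B" using B by (simp add: emeasure_eq_0_iff_AE)
    then show ?thesis unfolding B_def[symmetric] using AE_space by eventually_elim auto
  qed
  then have "AE x in M. \<forall>m. x \<in> (\<Union>n\<in>{m..}. (That ^^ n) A)"
    by (simp add: AE_all_countable)
  then show ?thesis by eventually_elim auto
qed

text \<open>The adjunction moves the hypothesis to preimages, where the inclusion iterates, and then
  moves each iterate back.\<close>

lemma orbit_subset_of_That_subset:
  assumes A: "A \<in> sets M" and "ae_subset M (That A) A"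
  shows "ae_subset M (\<Union>n\<in>{m..}. (That ^^ n) A) A"
proof -
  have "ae_subset M A (preim M T A)" using assms by (simp add: That_subset_iff)
  then show ?thesis
    using A by (intro ae_subset_UN) (auto simp: sets_That_funpow That_funpow_subset_iff subset_preim_funpow)
qed

lemma conservative_if_forward_invariant_conull:
  assumes conull: "\<And>A. A \<in> sets M \<Longrightarrow> emeasure M A > 0 \<Longrightarrow> ae_subset M (That A) A \<Longrightarrow>
    AE x in M. x \<in> A"
  shows "conservative M T"
  unfolding conservative_def
proof (intro allI impI, rule ccontr)
  fix W assume wand: "wandering M T W" and "emeasure M W \<noteq> 0"
  then have W: "W \<in> sets M" and pos: "emeasure M W > 0"
    by (auto simp: wandering_def zero_less_iff_neq_zero)
  \<comment> \<open>The union starts at \<open>1\<close> because the term for \<open>0\<close> is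
    \<open>W\<close> itself, which \<open>?B\<close> has to avoid.\<close>
  let ?B = "\<Union>n\<in>{1..}. (That ^^ n) W"
  have "AE x in M. x \<in> ?B"
    using W pos by (intro conull) (simp_all add: sets_tail emeasure_tail_pos That_subset_iff tail_subset_preim)
  moreover have "ae_subset M ?B (space M - W)"
  proof (rule ae_subset_UN)
    fix n :: nat assume n: "n \<in> {1..}"
    then have "ae_subset M W (space M - preim M (T ^^ n) W)"
      using wand W by (auto simp: wandering_def ae_equal_empty_inter_iff sets_preim_funpow)
    \<comment> \<open>Complements commute with preimages because \<open>T ^^ n\<close> maps
      \<open>space M\<close> into itself; the adjunction then yields that
      \<open>(That ^^ n) W\<close> misses \<open>W\<close>.\<close>
    also have "space M - preim M (T ^^ n) W = preim M (T ^^ n) (space M - W)"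
      using measurable_space[OF measurable_compose_n[OF T_measurable]] by (auto simp: preim_def)
    finally show "ae_subset M ((That ^^ n) W) (space M - W)"
      using W by (simp add: That_funpow_subset_iff)
  qed (use W in \<open>auto simp: sets_That_funpow\<close>)
  then have "AE x in M. x \<in> ?B \<longrightarrow> x \<in> space M - W"
    using W by (subst (asm) ae_subset_iff_AE) (auto simp: sets_tail)
  ultimately have "AE x in M. x \<notin> W" by eventually_elim auto
  with W \<open>emeasure M W \<noteq> 0\<close> show False by (simp add: emeasure_eq_0_iff_AE)
qed

text \<open>By the adjunction an invariant set almost contains its essential image, so if it is not
  null the hypothesis makes it conull.\<close>

lemma ergodic_if_forward_invariant_conull:
  assumes conull: "\<And>A. A \<in> sets M \<Longrightarrow> emeasure M A > 0 \<Longrightarrow> ae_subset M (That A) A \<Longrightarrow>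
    AE x in M. x \<in> A"
  shows "ergodic M T"
  unfolding ergodic_def
proof (intro allI impI disjCI)
  fix A assume inv: "invariant_set M T A" and "emeasure M (space M - A) \<noteq> 0"
  then have A: "A \<in> sets M" and "ae_subset M (That A) A"
    by (auto simp: invariant_set_def ae_equal_iff_AE That_subset_iff ae_subset_iff_AE sets_preim)
  moreover have "\<not> (AE x in M. x \<in> A)"
  proof
    assume "AE x in M. x \<in> A"
    then have "AE x in M. x \<notin> space M - A" by eventually_elim auto
    with A \<open>emeasure M (space M - A) \<noteq> 0\<close> show False by (simp add: emeasure_eq_0_iff_AE)
  qed
  ultimately show "emeasure M A = 0"
    using conull[of A] by (auto simp: zero_less_iff_neq_zero)
qed

end

theorem theorem4p6:
  fixes M :: "'a measure" and T :: "'a \<Rightarrow> 'a" and That :: "'a set \<Rightarrow> 'a set"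
  assumes "sigma_finite_measure M"
    and "null_preserving M T"
    and "essential_image_choice M T That"
  defines "cond_i \<equiv> conservative M T \<and> ergodic M T"
    and "cond_ii \<equiv> \<forall>A\<in>sets M. emeasure M A > 0 \<longrightarrow>
      ae_equal M (space M) (\<Union>n\<in>{1..}. (That ^^ n) A)"
    and "cond_iii \<equiv> \<forall>A\<in>sets M. emeasure M A > 0 \<longrightarrow>
      ae_equal M (space M) (\<Inter>m\<in>{1..}. \<Union>n\<in>{m..}. (That ^^ n) A)"
    and "cond_iv \<equiv> \<forall>A\<in>sets M. emeasure M A > 0 \<longrightarrow> ae_subset M (That A) A \<longrightarrow>
      ae_equal M (space M) A"
  shows "(cond_i \<longleftrightarrow> cond_ii) \<and> (cond_i \<longleftrightarrow> cond_iii) \<and> (cond_i \<longleftrightarrow> cond_iv)"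
proof -
  interpret essential_image_system M T That
    using assms(2,3) by unfold_locales
  have limsup_sets: "(\<Inter>m\<in>{1..}. \<Union>n\<in>{m..}. (That ^^ n) A) \<in> sets M" if "A \<in> sets M" for A
    using sets_tail[OF that] by (intro sets.countable_INT') auto
  \<comment> \<open>The equivalences follow from the cycle (i), (iii), (ii), (iv), (i).\<close>
  have i_iii: "cond_iii" if "cond_i"
    using that limsup_sets conservative_ergodic_imp_limsup_conull
    by (simp add: cond_i_def cond_iii_def ae_equal_space_iff del: INT_iff UN_iff)
  have iii_ii: "cond_ii" if iii: "cond_iii"
    unfolding cond_ii_def
  proof (intro ballI impI)
    fix A assume A: "A \<in> sets M" "emeasure M A > 0"
    then have "AE x in M. x \<in> (\<Inter>m\<in>{1..}. \<Union>n\<in>{m..}. (That ^^ n) A)"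
      using iii limsup_sets
      by (simp add: cond_iii_def ae_equal_space_iff del: INT_iff UN_iff)
    \<comment> \<open>The limit superior is contained in its tail for \<open>m = 1\<close>.\<close>
    then have "AE x in M. x \<in> (\<Union>n\<in>{1..}. (That ^^ n) A)" by eventually_elim auto
    with A show "ae_equal M (space M) (\<Union>n\<in>{1..}. (That ^^ n) A)"
      by (simp add: ae_equal_space_iff sets_tail del: UN_iff)
  qed
  have ii_iv: "cond_iv" if ii: "cond_ii"
    unfolding cond_iv_def
  proof (intro ballI impI)
    fix A assume A: "A \<in> sets M" "emeasure M A > 0" "ae_subset M (That A) A"
    let ?B = "\<Union>n\<in>{1..}. (That ^^ n) A"
    have "AE x in M. x \<in> ?B"
      using ii A by (simp add: cond_ii_def ae_equal_space_iff sets_tail del: UN_iff)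
    \<comment> \<open>Forward invariance confines the conull orbit \<open>?B\<close> to
      \<open>A\<close>.\<close>
    moreover have "AE x in M. x \<in> ?B \<longrightarrow> x \<in> A"
      using A orbit_subset_of_That_subset[of A 1] by (simp add: ae_subset_iff_AE sets_tail del: UN_iff)
    ultimately have "AE x in M. x \<in> A" by eventually_elim auto
    with A show "ae_equal M (space M) A" by (simp add: ae_equal_space_iff)
  qed
  have iv_i: "cond_i" if iv: "cond_iv"
  proof -
    have "AE x in M. x \<in> A" if "A \<in> sets M" "emeasure M A > 0" "ae_subset M (That A) A" for A
      using iv that by (simp add: cond_iv_def flip: ae_equal_space_iff)
    then show ?thesis unfolding cond_i_def
      by (intro conjI conservative_if_forward_invariant_conull ergodic_if_forward_invariant_conull)
  qed
  show ?thesis using i_iii iii_ii ii_iv iv_i by blast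
qed

end
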